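(* For every real number $c>2$ there exists an integer $n_0$ such that for all integers $n\ge n_0$, \[ R(\mathcal{Q}_2,\mathcal{Q}_n)\le n+c\,\frac{n}{\log_2 n}. \]
   Context: For a positive integer $N$, the Boolean lattice $\mathcal{Q}_N$ is the power set of $[N]=\{1,\dots,N\}$ ordered by inclusion. For posets $P$ and $Q$, an injection $f:P\to Q$ is an order-embedding if $f(x)\le f(y)$ holds if and only if $x\le y$; its image is called an induced copy of $P$ in $Q$, and $P$ is then an induced subposet of $Q$. For posets $P_1,P_2$, the (induced) poset Ramsey number $R(P_1,P_2)$ is the smallest integer $N$ such that for every coloring of the elements of $\mathcal{Q}_N$ with the two colors blue and red, there is an induced copy of $P_1$ all of whose elements are blue, or an induced copy of $P_2$ all of whose elements are red. *)

theory Defs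
  imports Complex_Main
begin

text \<open>Posets are subsets of types of class \<open>order\<close>, with the inherited order;
  on sets that order is inclusion.\<close>

definition boolean_lattice :: "nat \<Rightarrow> nat set set" where
  "boolean_lattice N = Pow {1..N}"

definition order_embedding :: "'a::order set \<Rightarrow> 'b::order set \<Rightarrow> ('a \<Rightarrow> 'b) \<Rightarrow> bool" where
  "order_embedding P Q f \<longleftrightarrow>
     f ` P \<subseteq> Q \<and> inj_on f P \<and> (\<forall>x\<in>P. \<forall>y\<in>P. f x \<le> f y \<longleftrightarrow> x \<le> y)"

definition induced_copy :: "'a::order set \<Rightarrow> 'b::order set \<Rightarrow> 'b set \<Rightarrow> bool" where
  "induced_copy P Q C \<longleftrightarrow> (\<exists>f. order_embedding P Q f \<and> C = f ` P)"

datatype colour = Blue | Red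

text \<open>A colouring is total on \<^typ>\<open>nat set\<close>; only its values on the lattice matter.\<close>

definition ramsey_arrow :: "'a::order set \<Rightarrow> 'b::order set \<Rightarrow> nat \<Rightarrow> bool" where
  "ramsey_arrow P1 P2 N \<longleftrightarrow>
     (\<forall>col :: nat set \<Rightarrow> colour.
        (\<exists>C. induced_copy P1 (boolean_lattice N) C \<and> (\<forall>x\<in>C. col x = Blue)) \<or>
        (\<exists>C. induced_copy P2 (boolean_lattice N) C \<and> (\<forall>x\<in>C. col x = Red)))"

text \<open>The minimum exists for all Boolean lattices, by lemma \<open>ramsey_arrow_exists\<close> below.\<close>

definition poset_ramsey :: "'a::order set \<Rightarrow> 'b::order set \<Rightarrow> nat" where
  "poset_ramsey P1 P2 = (LEAST N. N > 0 \<and> ramsey_arrow P1 P2 N)"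

lemma ramsey_arrow_exists:
  "\<exists>N>0. ramsey_arrow (boolean_lattice m) (boolean_lattice n) N"
proof -
  define N where "N = Suc (n * m + n + m)"
  define g :: "nat set \<Rightarrow> nat set \<Rightarrow> nat set" where
    "g = (\<lambda>S Z. S \<union> {n + 1..n + card S * m} \<union> (\<lambda>z. n + card S * m + z) ` Z)"
  have card_le: "card S \<le> n" if "S \<subseteq> {1..n}" for S
    using card_mono[OF _ that] by simp
  have g_in: "g S Z \<subseteq> {1..N}" if S: "S \<subseteq> {1..n}" and Z: "Z \<subseteq> {1..m}" for S Z
  proof -
    have "card S * m \<le> n * m" using card_le[OF S] by simp
    then have "n + card S * m + m \<le> N" unfolding N_def by linarith
    then have "y \<le> N" if "y \<in> g S Z" for y
      using that S Z unfolding g_def by fastforce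
    moreover have "y \<ge> 1" if "y \<in> g S Z" for y
      using that S Z unfolding g_def by fastforce
    ultimately show ?thesis by auto
  qed
  have g_Z: "g S Z \<subseteq> g S Z' \<longleftrightarrow> Z \<subseteq> Z'"
    if S: "S \<subseteq> {1..n}" and Z: "Z \<subseteq> {1..m}" for S Z Z'
  proof
    assume sub: "g S Z \<subseteq> g S Z'"
    show "Z \<subseteq> Z'"
    proof
      fix z assume z: "z \<in> Z"
      then have "n + card S * m + z \<in> g S Z'" using sub unfolding g_def by blast
      moreover have "z \<ge> 1" using z Z by auto
      ultimately show "z \<in> Z'" using S unfolding g_def by auto
    qed
  qed (auto simp: g_def)
  have g_S: "g S Z \<inter> {1..n} = S" if "S \<subseteq> {1..n}" "Z \<subseteq> {1..m}" for S Z
    using that unfolding g_def by fastforce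
  have g_mono: "g S Z \<subseteq> g T Z'"
    if ST: "S \<subset> T" and T: "T \<subseteq> {1..n}" and Z: "Z \<subseteq> {1..m}" for S T Z Z'
  proof -
    have "card S < card T"
      using psubset_card_mono[OF finite_subset[OF T] ST] by simp
    then have "Suc (card S) * m \<le> card T * m" by (intro mult_right_mono) auto
    then have "card S * m + m \<le> card T * m" by simp
    then show ?thesis using ST Z unfolding g_def by fastforce
  qed
  have "ramsey_arrow (boolean_lattice m) (boolean_lattice n) N"
    unfolding ramsey_arrow_def
  proof
    fix col :: "nat set \<Rightarrow> colour"
    show "(\<exists>C. induced_copy (boolean_lattice m) (boolean_lattice N) C \<and> (\<forall>x\<in>C. col x = Blue)) \<or>
          (\<exists>C. induced_copy (boolean_lattice n) (boolean_lattice N) C \<and> (\<forall>x\<in>C. col x = Red))"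
    proof (cases "\<exists>S. S \<subseteq> {1..n} \<and> (\<forall>Z. Z \<subseteq> {1..m} \<longrightarrow> col (g S Z) = Blue)")
      case True
      then obtain S where S: "S \<subseteq> {1..n}" and b: "\<And>Z. Z \<subseteq> {1..m} \<Longrightarrow> col (g S Z) = Blue"
        by blast
      have "inj_on (g S) (Pow {1..m})"
        by (rule inj_onI) (metis PowD S g_Z subset_antisym subset_refl)
      then have "order_embedding (boolean_lattice m) (boolean_lattice N) (g S)"
        using g_Z[OF S] g_in[OF S] unfolding order_embedding_def boolean_lattice_def by auto
      then show ?thesis
        using b unfolding induced_copy_def boolean_lattice_def by blast
    next
      case False
      then have "\<forall>S. \<exists>Z. S \<subseteq> {1..n} \<longrightarrow> Z \<subseteq> {1..m} \<and> col (g S Z) = Red"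
        by (metis colour.exhaust)
      then obtain h where
        h: "\<And>S. S \<subseteq> {1..n} \<Longrightarrow> h S \<subseteq> {1..m}" "\<And>S. S \<subseteq> {1..n} \<Longrightarrow> col (g S (h S)) = Red"
        by metis
      define f where "f = (\<lambda>S. g S (h S))"
      have f_le: "f S \<subseteq> f T \<longleftrightarrow> S \<subseteq> T" if S: "S \<subseteq> {1..n}" and T: "T \<subseteq> {1..n}" for S T
      proof
        assume "f S \<subseteq> f T"
        then show "S \<subseteq> T"
          using g_S[OF S h(1)[OF S]] g_S[OF T h(1)[OF T]] unfolding f_def by blast
      next
        assume "S \<subseteq> T"
        then show "f S \<subseteq> f T"
          using g_mono[OF _ T h(1)[OF S]] unfolding f_def by (cases "S = T") auto
      qed
      have "inj_on f (Pow {1..n})"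
        by (rule inj_onI) (metis PowD f_le subset_antisym subset_refl)
      moreover have "f ` Pow {1..n} \<subseteq> Pow {1..N}"
        using g_in h(1) unfolding f_def by blast
      ultimately have "order_embedding (boolean_lattice n) (boolean_lattice N) f"
        using f_le unfolding order_embedding_def boolean_lattice_def
        by (intro conjI ballI) (simp_all only: Pow_iff)
      then show ?thesis
        using h(2) unfolding induced_copy_def boolean_lattice_def f_def by auto
    qed
  qed
  then show ?thesis unfolding N_def by blast
qed

end

theory Submission
  imports Defs "HOL-Combinatorics.Permutations" "HOL-Real_Asymp.Real_Asymp"
begin

text \<open>Split the ground set into \<open>X\<close> with \<open>n\<close> elements and \<open>Y\<close> with \<open>k\<close> elements. For every
  ordering \<open>y\<^sub>1, \<dots>, y\<^sub>k\<close> of \<open>Y\<close>, either there is a red copy of the power set of \<open>X\<close>, or there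
  are \<open>X\<^sub>0 \<subseteq> \<dots> \<subseteq> X\<^sub>k \<subseteq> X\<close> such that all \<open>X\<^sub>i \<union> {y\<^sub>1, \<dots>, y\<^sub>i}\<close> are blue. If \<open>k! > 4\<^sup>n\<close>, two
  orderings yield the same pair \<open>(X\<^sub>0, X\<^sub>k)\<close>. Where these orderings have different initial
  segments of equal size, the two blue chains have incomparable members, and together with
  the common ends of the chains these form a blue copy of \<open>Q\<^sub>2\<close>. By Stirling,
  \<open>k! > 4\<^sup>n\<close> holds eventually for \<open>k\<close> about \<open>c n / log\<^sub>2 n\<close> with \<open>c > 2\<close>.\<close>

text \<open>A chain is recorded only by its traces \<open>Z i\<close> on the ground set outside the
  fixed sets \<open>P i\<close>. Inclusions are weak, and since \<open>Z\<close> increases, bounding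
  \<open>Z m\<close> by \<open>S\<close> bounds every \<open>Z i\<close> with
  \<open>i \<le> m\<close>.\<close>

definition blue_chain ::
  "(nat set \<Rightarrow> colour) \<Rightarrow> (nat \<Rightarrow> nat set) \<Rightarrow> nat set \<Rightarrow> nat \<Rightarrow> (nat \<Rightarrow> nat set) \<Rightarrow> bool" where
  "blue_chain col P S m Z \<longleftrightarrow>
     (\<forall>i<m. Z i \<subseteq> Z (Suc i)) \<and> Z m \<subseteq> S \<and> (\<forall>i\<le>m. col (Z i \<union> P i) = Blue)"

lemma blue_chain_mono:
  assumes "blue_chain col P S m Z" "i \<le> j" "j \<le> m"
  shows "Z i \<subseteq> Z j"
  using assms(2,3)
proof (induction j rule: dec_induct)
  case (step j)
  then have "Z j \<subseteq> Z (Suc j)" using assms(1) unfolding blue_chain_def by simp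
  with step show ?case by simp
qed simp

text \<open>Without a full chain, every \<open>S\<close> has a first unreachable level; its lift
  there is red, since a blue lift would extend a chain. Larger sets admit more chains, so the level
  grows with \<open>S\<close> and the lifting preserves inclusion.\<close>

lemma red_copy_or_blue_chain:
  fixes n k :: nat
  assumes P_mono: "mono P"
    and P_sub: "\<And>i. i \<le> k \<Longrightarrow> P i \<subseteq> {n + 1..n + k}"
  shows "(\<exists>C. induced_copy (boolean_lattice n) (boolean_lattice (n + k)) C \<and> (\<forall>x\<in>C. col x = Red))
    \<or> (\<exists>Z. blue_chain col P {1..n} k Z)"
proof (rule disjCI)
  assume no_chain: "\<nexists>Z. blue_chain col P {1..n} k Z"
  text \<open>\<open>S\<close> is lifted to the first level that no blue chain inside \<open>S\<close> reaches.\<close>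
  define l where "l S = (LEAST m. \<nexists>Z. blue_chain col P S m Z)" for S
  define f where "f S = S \<union> P (l S)" for S
  have superset: "blue_chain col P T m Z" if "blue_chain col P S m Z" "S \<subseteq> T" for S T m Z
    using that unfolding blue_chain_def by blast
  have no: "\<nexists>Z. blue_chain col P S k Z" if "S \<subseteq> {1..n}" for S
    using no_chain superset that by blast
  have l_no: "\<nexists>Z. blue_chain col P S (l S) Z" if "S \<subseteq> {1..n}" for S
    unfolding l_def by (rule LeastI) (rule no[OF that])
  have l_le: "l S \<le> k" if "S \<subseteq> {1..n}" for S
    unfolding l_def by (rule Least_le) (rule no[OF that])
  have l_mono: "l S \<le> l T" if "S \<subseteq> T" "T \<subseteq> {1..n}" for S T
    unfolding l_def[of S] by (rule Least_le) (use l_no superset that in blast)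
  have red: "col (f S) = Red" if S: "S \<subseteq> {1..n}" for S
  proof (rule ccontr)
    assume "col (f S) \<noteq> Red"
    then have blue: "col (S \<union> P (l S)) = Blue"
      unfolding f_def by (metis colour.exhaust)
    have "\<exists>Z. blue_chain col P S (l S) Z"
    proof (cases "l S")
      case 0
      then have "blue_chain col P S (l S) (\<lambda>_. S)"
        using blue unfolding blue_chain_def by simp
      then show ?thesis by blast
    next
      case (Suc m)
      then obtain Z where "blue_chain col P S m Z"
        using not_less_Least[of m "\<lambda>m. \<nexists>Z. blue_chain col P S m Z"] unfolding l_def by auto
      \<comment> \<open>By minimality a chain inside \<open>S\<close> reaches level
        \<open>m\<close>; as \<open>Z m \<subseteq> S\<close>, the set \<open>S\<close> itself can
        serve as the next trace.\<close>
      then have "blue_chain col P S (l S) (Z(Suc m := S))"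
        using blue Suc unfolding blue_chain_def by (auto simp: less_Suc_eq le_Suc_eq)
      then show ?thesis by blast
    qed
    then show False using l_no[OF S] by blast
  qed
  \<comment> \<open>Intersecting with \<open>{1..n}\<close> undoes the lifting, which gives
    injectivity and reflection of inclusion.\<close>
  have trace: "f S \<inter> {1..n} = S" if "S \<subseteq> {1..n}" for S
    using that P_sub[OF l_le[OF that]] unfolding f_def by fastforce
  have f_le: "f S \<subseteq> f T \<longleftrightarrow> S \<subseteq> T" if S: "S \<subseteq> {1..n}" and T: "T \<subseteq> {1..n}" for S T
  proof
    show "f S \<subseteq> f T \<Longrightarrow> S \<subseteq> T" using trace[OF S] trace[OF T] by blast
    show "S \<subseteq> T \<Longrightarrow> f S \<subseteq> f T"
      using monoD[OF P_mono l_mono[OF _ T]] unfolding f_def by blast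
  qed
  have "f S \<subseteq> {1..n + k}" if "S \<subseteq> {1..n}" for S
    using that P_sub[OF l_le[OF that]] unfolding f_def by fastforce
  moreover have "inj_on f (Pow {1..n})"
    by (rule inj_onI) (metis PowD trace)
  ultimately have "order_embedding (boolean_lattice n) (boolean_lattice (n + k)) f"
    using f_le unfolding order_embedding_def boolean_lattice_def by (auto simp del: atLeastAtMost_iff)
  then show "\<exists>C. induced_copy (boolean_lattice n) (boolean_lattice (n + k)) C \<and> (\<forall>x\<in>C. col x = Red)"
    using red unfolding induced_copy_def boolean_lattice_def by blast
qed

lemma induced_copy_diamond:
  assumes "A \<subseteq> C" "A \<subseteq> D" "C \<subseteq> B" "D \<subseteq> B" "B \<subseteq> {1..N}" "\<not> C \<subseteq> D" "\<not> D \<subseteq> C"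
  shows "induced_copy (boolean_lattice 2) (boolean_lattice N) {A, B, C, D}"
proof -
  define f where
    "f = (\<lambda>S::nat set. if 1 \<in> S then if 2 \<in> S then B else C else if 2 \<in> S then D else A)"
  have "{1..2::nat} = {1, 2}" by auto
  then have Q: "boolean_lattice 2 = {{}, {1}, {2}, {1, 2}}"
    unfolding boolean_lattice_def by auto
  have f: "f {} = A" "f {1} = C" "f {2} = D" "f {1, 2} = B"
    unfolding f_def by auto
  \<comment> \<open>Incomparability of \<open>C\<close> and \<open>D\<close> also keeps them away
    from the ends: \<open>C \<subseteq> A\<close> would force \<open>C \<subseteq> D\<close>, and
    \<open>B \<subseteq> C\<close> would force \<open>D \<subseteq> C\<close>.\<close>
  have le: "\<forall>S\<in>boolean_lattice 2. \<forall>T\<in>boolean_lattice 2. f S \<subseteq> f T \<longleftrightarrow> S \<subseteq> T"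
    using assms unfolding Q ball_simps f by auto
  then have "inj_on f (boolean_lattice 2)"
    by (intro inj_onI) (metis subset_antisym subset_refl)
  moreover have img: "f ` boolean_lattice 2 = {A, B, C, D}"
    unfolding Q image_insert f by auto
  moreover have "{A, B, C, D} \<subseteq> boolean_lattice N"
    using assms unfolding boolean_lattice_def by auto
  ultimately have "order_embedding (boolean_lattice 2) (boolean_lattice N) f"
    using le unfolding order_embedding_def by simp
  then show ?thesis
    unfolding induced_copy_def img[symmetric] by blast
qed

text \<open>The traces lie in \<open>{1..n}\<close> and the segments in
  \<open>{n + 1..n + k}\<close>, so incomparability of \<open>P i\<close> and \<open>Q i\<close>
  passes to \<open>Z i \<union> P i\<close> and \<open>W i \<union> Q i\<close>. The shared ends of
  the chains are bottom and top.\<close>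

lemma blue_diamond:
  assumes P: "mono P" "P k \<subseteq> {n + 1..n + k}" and Q: "mono Q" "Q k = P k" "Q 0 = P 0"
    and Z: "blue_chain col P {1..n} k Z" and W: "blue_chain col Q {1..n} k W"
    and ends: "Z 0 = W 0" "Z k = W k"
    and i: "i \<le> k" "\<not> P i \<subseteq> Q i" "\<not> Q i \<subseteq> P i" "Q i \<subseteq> {n + 1..n + k}"
  shows "\<exists>C. induced_copy (boolean_lattice 2) (boolean_lattice (n + k)) C \<and> (\<forall>x\<in>C. col x = Blue)"
proof -
  have mZ: "Z 0 \<subseteq> Z i" "Z i \<subseteq> Z k" and mW: "W 0 \<subseteq> W i" "W i \<subseteq> W k"
    using blue_chain_mono[OF Z] blue_chain_mono[OF W] i(1) by simp_all
  have mP: "P 0 \<subseteq> P i" "P i \<subseteq> P k" and mQ: "Q 0 \<subseteq> Q i" "Q i \<subseteq> Q k"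
    using P(1) Q(1) i(1) by (simp_all add: monoD)
  have Zk: "Z k \<subseteq> {1..n}" using Z unfolding blue_chain_def by blast
  have disj: "{1..n} \<inter> {n + 1..n + k} = {}" by auto
  have "induced_copy (boolean_lattice 2) (boolean_lattice (n + k))
    {Z 0 \<union> P 0, Z k \<union> P k, Z i \<union> P i, W i \<union> Q i}"
  proof (rule induced_copy_diamond)
    show "Z k \<union> P k \<subseteq> {1..n + k}" using Zk P(2) by fastforce
    have "W i \<inter> P i = {}" "Z i \<inter> Q i = {}"
      using mW(2) mZ(2) Zk ends(2) mP(2) P(2) i(4) disj by blast+
    then show "\<not> Z i \<union> P i \<subseteq> W i \<union> Q i" "\<not> W i \<union> Q i \<subseteq> Z i \<union> P i"
      using i(2,3) by blast+
  qed (use mZ mW mP mQ Q(2,3) ends in blast)+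
  then show ?thesis
    using Z W i(1) unfolding blue_chain_def by (metis empty_iff insert_iff order_refl zero_le)
qed

text \<open>An ordering of \<open>{n + 1..n + k}\<close> is encoded as a permutation of
  \<open>{..<k}\<close>, shifted by \<open>n + 1\<close> because its values start at 0.\<close>

definition initial_segment :: "nat \<Rightarrow> (nat \<Rightarrow> nat) \<Rightarrow> nat \<Rightarrow> nat set" where
  "initial_segment n p i = (\<lambda>j. n + 1 + p j) ` {..<i}"

lemma mono_initial_segment: "mono (initial_segment n p)"
  unfolding initial_segment_def by (auto intro!: monoI)

lemma initial_segment_full:
  assumes "p permutes {..<k}"
  shows "initial_segment n p k = {n + 1..n + k}"
proof -
  have "initial_segment n p k = (+) (n + 1) ` p ` {..<k}"
    unfolding initial_segment_def by (simp add: image_image)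
  also have "\<dots> = (+) (n + 1) ` {0..<k}"
    using permutes_image[OF assms] by (simp add: lessThan_atLeast0)
  also have "\<dots> = {n + 1..n + k}" by (simp only: image_add_atLeastLessThan) auto
  finally show ?thesis .
qed

lemma card_initial_segment:
  assumes "p permutes A"
  shows "card (initial_segment n p i) = i"
proof -
  have "inj_on (\<lambda>j. n + 1 + p j) {..<i}"
    by (rule inj_onI) (simp add: inj_eq[OF permutes_inj[OF assms]])
  then show ?thesis unfolding initial_segment_def by (simp only: card_image card_lessThan)
qed

text \<open>Where \<open>p j \<noteq> q j\<close>, the segments cannot agree at both
  \<open>j\<close> and \<open>Suc j\<close>, since the element added between them differs.\<close>

lemma initial_segments_differ:
  assumes p: "p permutes {..<k}" and q: "q permutes {..<k}" and "p \<noteq> q"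
  obtains i where "i \<le> k" "initial_segment n p i \<noteq> initial_segment n q i"
proof -
  obtain j where j: "p j \<noteq> q j" using \<open>p \<noteq> q\<close> by blast
  \<comment> \<open>Both permutations fix everything outside \<open>{..<k}\<close>.\<close>
  then have "j < k" using p q unfolding permutes_def by force
  have single: "initial_segment n r (Suc j) - initial_segment n r j = {n + 1 + r j}"
    if "r permutes {..<k}" for r
    unfolding initial_segment_def lessThan_Suc by (auto simp: inj_eq[OF permutes_inj[OF that]])
  have "initial_segment n p (Suc j) \<noteq> initial_segment n q (Suc j)
      \<or> initial_segment n p j \<noteq> initial_segment n q j"
    using single[OF p] single[OF q] j by auto
  then show thesis using that \<open>j < k\<close> by (meson Suc_leI less_imp_le)
qed

lemma ramsey_arrow_diamond:
  assumes "4 ^ n < (fact k :: nat)"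
  shows "ramsey_arrow (boolean_lattice 2) (boolean_lattice n) (n + k)"
  unfolding ramsey_arrow_def
proof (intro allI disjCI)
  fix col :: "nat set \<Rightarrow> colour"
  let ?P = "initial_segment n"
  let ?perms = "{p. p permutes {..<k}}"
  assume no_red: "\<not> (\<exists>C. induced_copy (boolean_lattice n) (boolean_lattice (n + k)) C
    \<and> (\<forall>x\<in>C. col x = Red))"
  have sub: "?P p i \<subseteq> {n + 1..n + k}" if "p permutes {..<k}" "i \<le> k" for p i
    using monoD[OF mono_initial_segment that(2)] initial_segment_full[OF that(1)] by blast
  have "\<forall>p. \<exists>Z. p permutes {..<k} \<longrightarrow> blue_chain col (?P p) {1..n} k Z"
    using red_copy_or_blue_chain[OF mono_initial_segment sub] no_red by blast
  then obtain Z where Z: "\<And>p. p permutes {..<k} \<Longrightarrow> blue_chain col (?P p) {1..n} k (Z p)"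
    by metis
  let ?ends = "\<lambda>p. (Z p 0, Z p k)"
  have "?ends ` ?perms \<subseteq> Pow {1..n} \<times> Pow {1..n}"
  proof (intro image_subsetI)
    fix p assume "p \<in> ?perms"
    then have "blue_chain col (?P p) {1..n} k (Z p)" using Z by simp
    then have "Z p 0 \<subseteq> Z p k" "Z p k \<subseteq> {1..n}"
      using blue_chain_mono[of col "?P p" "{1..n}" k "Z p" 0 k] unfolding blue_chain_def by auto
    then show "?ends p \<in> Pow {1..n} \<times> Pow {1..n}" by blast
  qed
  then have "card (?ends ` ?perms) \<le> card (Pow {1..n} \<times> Pow {1..n})"
    by (intro card_mono) auto
  also have "\<dots> = 4 ^ n"
    by (simp add: card_Pow card_cartesian_product flip: power_mult_distrib)
  also have "\<dots> < card ?perms"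
    using assms by (simp add: card_permutations[of "{..<k}" k])
  finally have "\<not> inj_on ?ends ?perms" by (rule pigeonhole)
  then obtain p q where p: "p permutes {..<k}" and q: "q permutes {..<k}" and "p \<noteq> q"
    and ends: "Z p 0 = Z q 0" "Z p k = Z q k"
    unfolding inj_on_def by auto
  then obtain i where i: "i \<le> k" "?P p i \<noteq> ?P q i"
    using initial_segments_differ by metis
  have fin: "finite (?P r i)" for r unfolding initial_segment_def by simp
  \<comment> \<open>Distinct finite sets of the same size \<open>i\<close> are incomparable.\<close>
  have "\<not> ?P p i \<subseteq> ?P q i" "\<not> ?P q i \<subseteq> ?P p i"
    using card_subset_eq[OF fin] card_initial_segment[OF p] card_initial_segment[OF q] i(2) by metis+
  then show "\<exists>C. induced_copy (boolean_lattice 2) (boolean_lattice (n + k)) C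
    \<and> (\<forall>x\<in>C. col x = Blue)"
    using blue_diamond[OF mono_initial_segment _ mono_initial_segment _ _ Z[OF p] Z[OF q] ends i(1)]
      initial_segment_full[OF p] initial_segment_full[OF q] sub[OF q i(1)]
    by (simp add: initial_segment_def[of _ _ 0])
qed

text \<open>A weak Stirling bound: \<open>k ^ k / fact k\<close> is a single term of the exponential
  series for \<open>exp k\<close>, hence at most \<open>exp k\<close>.\<close>

lemma ln_fact_ge:
  assumes "k > 0"
  shows "real k * (ln (real k) - 1) \<le> ln (fact k)"
proof -
  have sums: "(\<lambda>i. real k ^ i / fact i) sums exp (real k)"
    using exp_converges[of "real k"] by (simp only: real_scaleR_def divide_inverse mult.commute)
  have "(\<Sum>i\<in>{k}. real k ^ i / fact i) \<le> (\<Sum>i. real k ^ i / fact i)"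
    by (rule sum_le_suminf[OF sums_summable[OF sums]]) auto
  then have "real k ^ k / fact k \<le> exp (real k)"
    unfolding sums_unique[OF sums, symmetric] by simp
  then have "ln (real k ^ k / fact k) \<le> real k"
    using assms ln_mono[of "real k ^ k / fact k" "exp (real k)"] by simp
  then show ?thesis
    using assms by (simp add: ln_div ln_realpow algebra_simps)
qed

text \<open>For \<open>k\<close> about \<open>c * n / log 2 n\<close>, \<open>ln k\<close> is
  asymptotic to \<open>ln n\<close>, so \<open>k * (ln k - 1)\<close> is asymptotic to
  \<open>c * n * ln 2\<close>. This beats \<open>ln (4 ^ n) = 2 * n * ln 2\<close> because
  \<open>c > 2\<close>.\<close>

lemma eventually_four_power_less_fact:
  fixes c :: real
  assumes "c > 2"
  shows "\<forall>\<^sub>F n in sequentially. 4 ^ n < (fact (nat \<lfloor>c * (real n / log 2 (real n))\<rfloor>) :: nat)"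
proof -
  \<comment> \<open>Subtracting 1 gives a smooth lower bound for the rounded value
    \<open>k\<close>.\<close>
  define y where "y n = c * (real n / log 2 (real n)) - 1" for n
  have c: "c > 0" using assms by simp
  have "((\<lambda>n. y n * (ln (y n) - 1) / real n) \<longlongrightarrow> c * ln 2) sequentially"
    using c unfolding y_def log_def by real_asymp
  moreover have "2 * ln 2 < c * ln (2::real)" using assms by simp
  ultimately have "\<forall>\<^sub>F n in sequentially. 2 * ln 2 < y n * (ln (y n) - 1) / real n"
    by (rule order_tendstoD(1))
  moreover have "filterlim y at_top sequentially"
    using c unfolding y_def log_def by real_asymp
  \<comment> \<open>From \<open>exp 1\<close> on, \<open>ln (y n) - 1\<close> is nonnegative, so the
    product can be compared factor by factor when \<open>y n\<close> is replaced by
    \<open>k\<close>.\<close>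
  then have "\<forall>\<^sub>F n in sequentially. y n \<ge> exp 1"
    by (simp add: filterlim_at_top)
  moreover have "\<forall>\<^sub>F n::nat in sequentially. n > 0" by (rule eventually_gt_at_top)
  ultimately show ?thesis
  proof eventually_elim
    case (elim n)
    define k where "k = nat \<lfloor>c * (real n / log 2 (real n))\<rfloor>"
    have y0: "y n > 0" using elim(2) exp_gt_zero[of "1::real"] by linarith
    have k: "y n \<le> real k" unfolding k_def y_def by linarith
    have k0: "k > 0" using y0 k by (cases k) auto
    have ln_y: "1 \<le> ln (y n)" using elim(2) y0 by (simp add: ln_ge_iff)
    have "ln (4 ^ n) = real n * (2 * ln (2::real))"
      using ln_realpow[of "2::real" 2] by (simp add: ln_realpow)
    also have "\<dots> < y n * (ln (y n) - 1)"
      using elim by (simp add: field_simps)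
    also have "\<dots> \<le> real k * (ln (real k) - 1)"
      using k y0 ln_y by (intro mult_mono) auto
    also have "\<dots> \<le> ln (fact k)" by (rule ln_fact_ge[OF k0])
    finally have "(4::real) ^ n < fact k" by simp
    then have "real (4 ^ n) < real (fact k)" by simp
    then show ?case unfolding k_def of_nat_less_iff .
  qed
qed

theorem theorem1:
  fixes c :: real
  assumes "c > 2"
  shows "\<exists>n0::nat. \<forall>n\<ge>n0.
    real (poset_ramsey (boolean_lattice 2) (boolean_lattice n))
      \<le> real n + c * (real n / log 2 (real n))"
proof -
  have "\<forall>\<^sub>F n in sequentially. real (poset_ramsey (boolean_lattice 2) (boolean_lattice n))
      \<le> real n + c * (real n / log 2 (real n))"
    using eventually_four_power_less_fact[OF assms] eventually_gt_at_top[of "1::nat"]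
  proof eventually_elim
    case (elim n)
    let ?x = "c * (real n / log 2 (real n))"
    have "poset_ramsey (boolean_lattice 2) (boolean_lattice n) \<le> n + nat \<lfloor>?x\<rfloor>"
      unfolding poset_ramsey_def
      by (rule Least_le) (use elim(2) ramsey_arrow_diamond[OF elim(1)] in simp)
    \<comment> \<open>For \<open>n > 1\<close> the logarithm is positive; nonnegativity ensures that
      \<open>nat\<close> of the floor does not exceed \<open>?x\<close>.\<close>
    moreover have "?x \<ge> 0" using assms elim(2) by simp
    ultimately show ?case by linarith
  qed
  then show ?thesis unfolding eventually_sequentially .
qed

end
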